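(* Let $(M,J,g)$ and $(M,J,\tilde g)$ be quasi-Kähler manifolds with Norden metric, where $\tilde g(X,Y)=g(X,JY)$ is the metric associated with $g$. Then the curvature tensors $R$ of $\nabla$ and $\tilde R$ of $\tilde\nabla$ (of type $(0,4)$) satisfy, for all $x,y,z,u$, $$\begin{aligned}\tilde R(x,y,z,u)={}&R(x,y,z,Ju)-(\nabla_xF)(u,y,z)+(\nabla_yF)(u,x,z)\\&-g\bigl((\nabla_yJ)z+(\nabla_zJ)y,\,(\nabla_xJ)Ju+(\nabla_uJ)Jx\bigr)\\&+g\bigl((\nabla_xJ)z+(\nabla_zJ)x,\,(\nabla_yJ)Ju+(\nabla_uJ)Jy\bigr).\end{aligned}$$
   Context: An almost complex manifold with Norden metric $(M,J,g)$ is a smooth $2n$-dimensional manifold with a $(1,1)$-tensor field $J$ and a pseudo-Riemannian metric $g$ such that $J^2X=-X$ and $g(JX,JY)=-g(X,Y)$ for all vector fields $X,Y$ ($g$ is then necessarily of signature $(n,n)$). The associated metric $\tilde g(X,Y)=g(X,JY)$ is then also a Norden metric. Let $\nabla$, $\tilde\nabla$ be the Levi-Civita connections of $g$, $\tilde g$, and set $F(X,Y,Z)=g((\nabla_XJ)Y,Z)$ and $\tilde F(X,Y,Z)=\tilde g((\tilde\nabla_XJ)Y,Z)$. The manifold $(M,J,g)$ is called quasi-Kähler with Norden metric (class $\mathcal W_3$) if $F(X,Y,Z)+F(Y,Z,X)+F(Z,X,Y)=0$ for all $X,Y,Z$; likewise $(M,J,\tilde g)$ is quasi-Kähler with Norden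 metric if the cyclic sum of $\tilde F$ vanishes. Curvature conventions: $R(X,Y)Z=\nabla_X\nabla_YZ-\nabla_Y\nabla_XZ-\nabla_{[X,Y]}Z$, $R(X,Y,Z,U)=g(R(X,Y)Z,U)$; $\tilde R(X,Y)Z$ is defined in the same way from $\tilde\nabla$, and $\tilde R(X,Y,Z,U)=\tilde g(\tilde R(X,Y)Z,U)$. *)

theory Defs
  imports "HOL-Analysis.Analysis" "HOL-Library.Function_Algebras"
begin

section \<open>Smooth manifolds\<close>

text \<open>\<open>Ck_on k S f\<close> is meant for open sets \<open>S\<close>: all iterated directional derivatives of order less
  than \<open>k\<close> are differentiable on \<open>S\<close>, and those of order \<open>k\<close> are continuous on \<open>S\<close>.\<close>

primrec Ck_on ::
  "nat \<Rightarrow> 'a::real_normed_vector set \<Rightarrow> ('a \<Rightarrow> 'b::real_normed_vector) \<Rightarrow> bool" where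
  "Ck_on 0 S f \<longleftrightarrow> continuous_on S f"
| "Ck_on (Suc k) S f \<longleftrightarrow> (\<forall>x\<in>S. f differentiable (at x)) \<and>
     (\<forall>v. Ck_on k S (\<lambda>x. frechet_derivative f (at x) v))"

definition smooth_on ::
  "'a::real_normed_vector set \<Rightarrow> ('a \<Rightarrow> 'b::real_normed_vector) \<Rightarrow> bool" where
  "smooth_on S f \<longleftrightarrow> (\<forall>k. Ck_on k S f)"

text \<open>The underlying space of the manifold is the whole type \<open>'m\<close>; a chart is a pair of its domain and
  its coordinate map, the values of the latter outside the domain being irrelevant. Taking both orders
  of two charts, the last condition makes every transition map a diffeomorphism.\<close>

definition smooth_atlas ::
  "('m::{t2_space,second_countable_topology} set \<times> ('m \<Rightarrow> 'e::euclidean_space)) set \<Rightarrow> bool" where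
  "smooth_atlas A \<longleftrightarrow>
     \<Union> (fst ` A) = UNIV \<and>
     (\<forall>(U, \<phi>)\<in>A. open U \<and> open (\<phi> ` U) \<and> homeomorphism U (\<phi> ` U) \<phi> (inv_into U \<phi>)) \<and>
     (\<forall>(U, \<phi>)\<in>A. \<forall>(V, \<psi>)\<in>A. smooth_on (\<phi> ` (U \<inter> V)) (\<psi> \<circ> inv_into U \<phi>))"

definition smooth_funs :: "('m set \<times> ('m \<Rightarrow> 'e::euclidean_space)) set \<Rightarrow> ('m \<Rightarrow> real) set" where
  "smooth_funs A = {f. \<forall>(U, \<phi>)\<in>A. smooth_on (\<phi> ` U) (f \<circ> inv_into U \<phi>)}"


section \<open>Tangent vectors and vector fields\<close>

text \<open>Tangent vectors at \<open>p\<close> are the derivations at \<open>p\<close> of the algebra of smooth functions; they are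
  required to vanish on non-smooth functions, so that equality of functionals is equality of vectors.
  The vector space operations \<open>+\<close>, \<open>-\<close>, \<open>0\<close> are the pointwise ones on functions.\<close>

type_synonym 'm tvec = "('m \<Rightarrow> real) \<Rightarrow> real"
type_synonym 'm field = "'m \<Rightarrow> 'm tvec"

definition tangent_space :: "('m set \<times> ('m \<Rightarrow> 'e::euclidean_space)) set \<Rightarrow> 'm \<Rightarrow> 'm tvec set" where
  "tangent_space A p = {v.
     (\<forall>f\<in>smooth_funs A. \<forall>h\<in>smooth_funs A. \<forall>a b.
        v (\<lambda>q. a * f q + b * h q) = a * v f + b * v h) \<and>
     (\<forall>f\<in>smooth_funs A. \<forall>h\<in>smooth_funs A.
        v (\<lambda>q. f q * h q) = v f * h p + f p * v h) \<and>
     (\<forall>f. f \<notin> smooth_funs A \<longrightarrow> v f = 0)}"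

definition lincomb :: "real \<Rightarrow> 'm tvec \<Rightarrow> real \<Rightarrow> 'm tvec \<Rightarrow> 'm tvec" where
  "lincomb a v b w = (\<lambda>f. a * v f + b * w f)"

definition dir_deriv :: "'m field \<Rightarrow> ('m \<Rightarrow> real) \<Rightarrow> 'm \<Rightarrow> real" where
  "dir_deriv X f = (\<lambda>p. X p f)"

definition vector_fields :: "('m set \<times> ('m \<Rightarrow> 'e::euclidean_space)) set \<Rightarrow> 'm field set" where
  "vector_fields A = {X. (\<forall>p. X p \<in> tangent_space A p) \<and>
     (\<forall>f\<in>smooth_funs A. dir_deriv X f \<in> smooth_funs A)}"

definition fun_scale :: "('m \<Rightarrow> real) \<Rightarrow> 'm field \<Rightarrow> 'm field" where
  "fun_scale h X = (\<lambda>p f. h p * X p f)"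

definition lie_bracket :: "'m field \<Rightarrow> 'm field \<Rightarrow> 'm field" where
  "lie_bracket X Y = (\<lambda>p f. X p (dir_deriv Y f) - Y p (dir_deriv X f))"


section \<open>Tensor fields of type (1,1), pseudo-Riemannian metrics\<close>

definition app11 :: "('m \<Rightarrow> 'm tvec \<Rightarrow> 'm tvec) \<Rightarrow> 'm field \<Rightarrow> 'm field" where
  "app11 J X = (\<lambda>p. J p (X p))"

definition app02 :: "('m \<Rightarrow> 'm tvec \<Rightarrow> 'm tvec \<Rightarrow> real) \<Rightarrow> 'm field \<Rightarrow> 'm field \<Rightarrow> 'm \<Rightarrow> real" where
  "app02 g X Y = (\<lambda>p. g p (X p) (Y p))"

definition tensor11 ::
  "('m set \<times> ('m \<Rightarrow> 'e::euclidean_space)) set \<Rightarrow> ('m \<Rightarrow> 'm tvec \<Rightarrow> 'm tvec) \<Rightarrow> bool" where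
  "tensor11 A J \<longleftrightarrow>
     (\<forall>p. \<forall>v\<in>tangent_space A p. J p v \<in> tangent_space A p) \<and>
     (\<forall>p. \<forall>v\<in>tangent_space A p. \<forall>w\<in>tangent_space A p. \<forall>a b.
        J p (lincomb a v b w) = lincomb a (J p v) b (J p w)) \<and>
     (\<forall>X\<in>vector_fields A. app11 J X \<in> vector_fields A)"

text \<open>No condition on the index is included: for the Norden metrics below the signature is
  automatically neutral.\<close>

definition pseudo_riemannian_metric ::
  "('m set \<times> ('m \<Rightarrow> 'e::euclidean_space)) set \<Rightarrow> ('m \<Rightarrow> 'm tvec \<Rightarrow> 'm tvec \<Rightarrow> real) \<Rightarrow> bool" where
  "pseudo_riemannian_metric A g \<longleftrightarrow>
     (\<forall>p. \<forall>v\<in>tangent_space A p. \<forall>w\<in>tangent_space A p. g p v w = g p w v) \<and>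
     (\<forall>p. \<forall>u\<in>tangent_space A p. \<forall>v\<in>tangent_space A p. \<forall>w\<in>tangent_space A p. \<forall>a b.
        g p (lincomb a u b v) w = a * g p u w + b * g p v w) \<and>
     (\<forall>p. \<forall>v\<in>tangent_space A p. (\<forall>w\<in>tangent_space A p. g p v w = 0) \<longrightarrow> v = 0) \<and>
     (\<forall>X\<in>vector_fields A. \<forall>Y\<in>vector_fields A. app02 g X Y \<in> smooth_funs A)"


section \<open>Connections and curvature\<close>

definition affine_connection ::
  "('m set \<times> ('m \<Rightarrow> 'e::euclidean_space)) set \<Rightarrow> ('m field \<Rightarrow> 'm field \<Rightarrow> 'm field) \<Rightarrow> bool" where
  "affine_connection A D \<longleftrightarrow>
     (\<forall>X\<in>vector_fields A. \<forall>Y\<in>vector_fields A. D X Y \<in> vector_fields A) \<and>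
     (\<forall>X\<in>vector_fields A. \<forall>Y\<in>vector_fields A. \<forall>Z\<in>vector_fields A.
        D (X + Y) Z = D X Z + D Y Z \<and> D X (Y + Z) = D X Y + D X Z) \<and>
     (\<forall>f\<in>smooth_funs A. \<forall>X\<in>vector_fields A. \<forall>Y\<in>vector_fields A.
        D (fun_scale f X) Y = fun_scale f (D X Y) \<and>
        D X (fun_scale f Y) = fun_scale (dir_deriv X f) Y + fun_scale f (D X Y))"

definition levi_civita ::
  "('m set \<times> ('m \<Rightarrow> 'e::euclidean_space)) set \<Rightarrow> ('m \<Rightarrow> 'm tvec \<Rightarrow> 'm tvec \<Rightarrow> real) \<Rightarrow>
   ('m field \<Rightarrow> 'm field \<Rightarrow> 'm field) \<Rightarrow> bool" where
  "levi_civita A g D \<longleftrightarrow> affine_connection A D \<and>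
     (\<forall>X\<in>vector_fields A. \<forall>Y\<in>vector_fields A. D X Y - D Y X = lie_bracket X Y) \<and>
     (\<forall>X\<in>vector_fields A. \<forall>Y\<in>vector_fields A. \<forall>Z\<in>vector_fields A.
        dir_deriv X (app02 g Y Z) = app02 g (D X Y) Z + app02 g Y (D X Z))"

definition curvature ::
  "('m field \<Rightarrow> 'm field \<Rightarrow> 'm field) \<Rightarrow> 'm field \<Rightarrow> 'm field \<Rightarrow> 'm field \<Rightarrow> 'm field" where
  "curvature D X Y Z = D X (D Y Z) - D Y (D X Z) - D (lie_bracket X Y) Z"

definition curvature04 ::
  "('m \<Rightarrow> 'm tvec \<Rightarrow> 'm tvec \<Rightarrow> real) \<Rightarrow> ('m field \<Rightarrow> 'm field \<Rightarrow> 'm field) \<Rightarrow>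
   'm field \<Rightarrow> 'm field \<Rightarrow> 'm field \<Rightarrow> 'm field \<Rightarrow> 'm \<Rightarrow> real" where
  "curvature04 g D X Y Z U = app02 g (curvature D X Y Z) U"

text \<open>\<open>cov_deriv11 D J X Y\<close> is \<open>(D\<^sub>X J) Y\<close>.\<close>

definition cov_deriv11 ::
  "('m field \<Rightarrow> 'm field \<Rightarrow> 'm field) \<Rightarrow> ('m \<Rightarrow> 'm tvec \<Rightarrow> 'm tvec) \<Rightarrow>
   'm field \<Rightarrow> 'm field \<Rightarrow> 'm field" where
  "cov_deriv11 D J X Y = D X (app11 J Y) - app11 J (D X Y)"

text \<open>\<open>cov_deriv03 D T W X Y Z\<close> is \<open>(D\<^sub>W T)(X, Y, Z)\<close>.\<close>

definition cov_deriv03 ::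
  "('m field \<Rightarrow> 'm field \<Rightarrow> 'm field) \<Rightarrow> ('m field \<Rightarrow> 'm field \<Rightarrow> 'm field \<Rightarrow> 'm \<Rightarrow> real) \<Rightarrow>
   'm field \<Rightarrow> 'm field \<Rightarrow> 'm field \<Rightarrow> 'm field \<Rightarrow> 'm \<Rightarrow> real" where
  "cov_deriv03 D T W X Y Z =
     dir_deriv W (T X Y Z) - T (D W X) Y Z - T X (D W Y) Z - T X Y (D W Z)"


section \<open>Almost complex manifolds with Norden metric\<close>

definition almost_complex_norden ::
  "nat \<Rightarrow> ('m::{t2_space,second_countable_topology} set \<times> ('m \<Rightarrow> 'e::euclidean_space)) set \<Rightarrow>
   ('m \<Rightarrow> 'm tvec \<Rightarrow> 'm tvec) \<Rightarrow> ('m \<Rightarrow> 'm tvec \<Rightarrow> 'm tvec \<Rightarrow> real) \<Rightarrow> bool" where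
  "almost_complex_norden n A J g \<longleftrightarrow>
     smooth_atlas A \<and> DIM('e) = 2 * n \<and> tensor11 A J \<and> pseudo_riemannian_metric A g \<and>
     (\<forall>p. \<forall>v\<in>tangent_space A p. J p (J p v) = - v) \<and>
     (\<forall>p. \<forall>v\<in>tangent_space A p. \<forall>w\<in>tangent_space A p. g p (J p v) (J p w) = - g p v w)"

definition associated_metric ::
  "('m \<Rightarrow> 'm tvec \<Rightarrow> 'm tvec) \<Rightarrow> ('m \<Rightarrow> 'm tvec \<Rightarrow> 'm tvec \<Rightarrow> real) \<Rightarrow>
   'm \<Rightarrow> 'm tvec \<Rightarrow> 'm tvec \<Rightarrow> real" where
  "associated_metric J g = (\<lambda>p v w. g p v (J p w))"

definition fundamental_tensor ::
  "('m \<Rightarrow> 'm tvec \<Rightarrow> 'm tvec) \<Rightarrow> ('m \<Rightarrow> 'm tvec \<Rightarrow> 'm tvec \<Rightarrow> real) \<Rightarrow>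
   ('m field \<Rightarrow> 'm field \<Rightarrow> 'm field) \<Rightarrow> 'm field \<Rightarrow> 'm field \<Rightarrow> 'm field \<Rightarrow> 'm \<Rightarrow> real" where
  "fundamental_tensor J g D X Y Z = app02 g (cov_deriv11 D J X Y) Z"

text \<open>The Levi-Civita connection \<open>D\<close> of \<open>g\<close> is carried along as a parameter; its values are
  determined by \<open>g\<close> on smooth vector fields and arbitrary elsewhere.\<close>

definition quasi_kaehler_norden ::
  "nat \<Rightarrow> ('m::{t2_space,second_countable_topology} set \<times> ('m \<Rightarrow> 'e::euclidean_space)) set \<Rightarrow>
   ('m \<Rightarrow> 'm tvec \<Rightarrow> 'm tvec) \<Rightarrow> ('m \<Rightarrow> 'm tvec \<Rightarrow> 'm tvec \<Rightarrow> real) \<Rightarrow>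
   ('m field \<Rightarrow> 'm field \<Rightarrow> 'm field) \<Rightarrow> bool" where
  "quasi_kaehler_norden n A J g D \<longleftrightarrow>
     almost_complex_norden n A J g \<and> levi_civita A g D \<and>
     (\<forall>X\<in>vector_fields A. \<forall>Y\<in>vector_fields A. \<forall>Z\<in>vector_fields A.
        fundamental_tensor J g D X Y Z + fundamental_tensor J g D Y Z X
          + fundamental_tensor J g D Z X Y = 0)"

end

theory Submission
  imports Defs
begin

text \<open>Koszul's formula, evaluated with the connection \<open>D\<close> of \<open>g\<close> and simplified by the cyclic identity,
  gives \<open>g'(D'\<^sub>X Y - D\<^sub>X Y, Z) = - F(Z, X, Y)\<close>; by \<open>g(Jv, w) = g(v, Jw)\<close> this says
  \<open>J(D'\<^sub>X Y - D\<^sub>X Y) = (D\<^sub>X J)Y + (D\<^sub>Y J)X\<close> when paired with vector fields. Inserting it twice into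
  \<open>g'(D'\<^sub>x D'\<^sub>y z, u)\<close> and antisymmetrising in \<open>x\<close>, \<open>y\<close> yields the curvature identity. Only pairings with
  vector fields occur, so no extension of tangent vectors to fields is needed.\<close>

section \<open>Linear structure of functions and fields\<close>

text \<open>Derivatives at a point of an open set see only a neighbourhood inside it, so agreement
  on \<open>S\<close> passes to the derivatives and the induction goes through.\<close>

lemma Ck_on_cong:
  assumes "open S" "\<And>x. x \<in> S \<Longrightarrow> f x = h x" "Ck_on k S f"
  shows "Ck_on k S h"
  using assms(2,3)
proof (induction k arbitrary: f h)
  case 0
  then show ?case using continuous_on_cong by force
next
  case (Suc k)
  have *: "(h has_derivative frechet_derivative f (at x)) (at x)" if "x \<in> S" for x
    using that Suc.prems assms(1)
    by (auto intro: has_derivative_transform_within_open simp: frechet_derivative_works)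
  then have "frechet_derivative h (at x) = frechet_derivative f (at x)" if "x \<in> S" for x
    using that frechet_derivative_at by metis
  then have "Ck_on k S (\<lambda>x. frechet_derivative h (at x) v)" for v
    using Suc.IH[of "\<lambda>x. frechet_derivative f (at x) v"] Suc.prems by simp
  with * show ?case by (auto simp: differentiable_def)
qed

lemma Ck_on_lincomb:
  fixes f h :: "'a::real_normed_vector \<Rightarrow> real"
  assumes "open S" "Ck_on k S f" "Ck_on k S h"
  shows "Ck_on k S (\<lambda>x. a * f x + b * h x)"
  using assms(2,3)
proof (induction k arbitrary: f h)
  case 0
  then show ?case by (simp add: continuous_on_add continuous_on_mult_left)
next
  case (Suc k)
  let ?f' = "\<lambda>x. frechet_derivative f (at x)" and ?h' = "\<lambda>x. frechet_derivative h (at x)"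
  have *: "((\<lambda>x. a * f x + b * h x) has_derivative (\<lambda>v. a * ?f' x v + b * ?h' x v)) (at x)"
    if "x \<in> S" for x
    using that Suc.prems
    by (intro derivative_intros has_derivative_mult_right) (auto simp: frechet_derivative_works)
  have "Ck_on k S (\<lambda>x. a * ?f' x v + b * ?h' x v)" for v
    using Suc by simp
  \<comment> \<open>The formula for the derivative is known only at points of \<open>S\<close>,
    hence the passage through \<open>Ck_on_cong\<close>.\<close>
  moreover have "frechet_derivative (\<lambda>x. a * f x + b * h x) (at x) = (\<lambda>v. a * ?f' x v + b * ?h' x v)"
    if "x \<in> S" for x
    using frechet_derivative_at[OF *[OF that]] by simp
  ultimately have "Ck_on k S (\<lambda>x. frechet_derivative (\<lambda>x. a * f x + b * h x) (at x) v)" for v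
    using Ck_on_cong[OF assms(1), of "\<lambda>x. a * ?f' x v + b * ?h' x v"] by simp
  with differentiableI[OF *] show ?case by simp
qed

lemma smooth_funs_lincomb:
  assumes "smooth_atlas A" "f \<in> smooth_funs A" "h \<in> smooth_funs A"
  shows "(\<lambda>q. a * f q + b * h q) \<in> smooth_funs A"
proof -
  have "smooth_on (\<phi> ` U) ((\<lambda>q. a * f q + b * h q) \<circ> inv_into U \<phi>)" if "(U, \<phi>) \<in> A" for U \<phi>
  proof -
    have "open (\<phi> ` U)"
      using assms(1) that by (auto simp: smooth_atlas_def)
    moreover have "smooth_on (\<phi> ` U) (f \<circ> inv_into U \<phi>)" "smooth_on (\<phi> ` U) (h \<circ> inv_into U \<phi>)"
      using assms(2,3) that by (auto simp: smooth_funs_def)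
    ultimately show ?thesis
      using Ck_on_lincomb[of "\<phi> ` U" _ "f \<circ> inv_into U \<phi>" "h \<circ> inv_into U \<phi>" a b]
      by (simp add: smooth_on_def o_def)
  qed
  then show ?thesis by (auto simp: smooth_funs_def)
qed

section \<open>Linear combinations of tangent vectors and of vector fields\<close>

lemma tangent_space_lincomb:
  assumes "v \<in> tangent_space A p" "w \<in> tangent_space A p"
  shows "lincomb a v b w \<in> tangent_space A p"
  using assms unfolding tangent_space_def lincomb_def
  by (simp add: algebra_simps)

lemma vector_fields_lincomb:
  assumes "smooth_atlas A" "X \<in> vector_fields A" "Y \<in> vector_fields A"
  shows "(\<lambda>p. lincomb a (X p) b (Y p)) \<in> vector_fields A"
proof -
  have "dir_deriv (\<lambda>p. lincomb a (X p) b (Y p)) f \<in> smooth_funs A" if "f \<in> smooth_funs A" for f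
    using smooth_funs_lincomb[OF assms(1), of "dir_deriv X f" "dir_deriv Y f" a b] assms(2,3) that
    by (simp add: vector_fields_def dir_deriv_def lincomb_def)
  then show ?thesis
    using assms(2,3) by (simp add: vector_fields_def tangent_space_lincomb)
qed

text \<open>Linearity of \<open>J\<close> and \<open>g\<close> is stated through
  \<open>lincomb\<close>; these two cases translate it to the pointwise operations on
  fields.\<close>

lemma lincomb_add: "lincomb 1 v 1 w = v + w"
  and lincomb_diff: "lincomb 1 v (-1) w = v - w"
  by (auto simp: lincomb_def fun_eq_iff)

lemma vector_fields_add:
  "smooth_atlas A \<Longrightarrow> X \<in> vector_fields A \<Longrightarrow> Y \<in> vector_fields A \<Longrightarrow> X + Y \<in> vector_fields A"
  using vector_fields_lincomb[of A X Y 1 1] by (simp add: lincomb_add plus_fun_def)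

lemma vector_fields_diff:
  "smooth_atlas A \<Longrightarrow> X \<in> vector_fields A \<Longrightarrow> Y \<in> vector_fields A \<Longrightarrow> X - Y \<in> vector_fields A"
  using vector_fields_lincomb[of A X Y 1 "-1"] by (simp add: lincomb_diff fun_diff_def)

text \<open>Tangent vectors are linear on smooth functions only, so smoothness has to be supplied
  whenever a difference is differentiated.\<close>

lemma dir_deriv_diff:
  assumes "X \<in> vector_fields A" "f \<in> smooth_funs A" "h \<in> smooth_funs A"
  shows "dir_deriv X (f - h) = dir_deriv X f - dir_deriv X h"
proof
  fix p
  have "X p (\<lambda>q. 1 * f q + (-1) * h q) = 1 * X p f + (-1) * X p h"
    using assms unfolding vector_fields_def tangent_space_def by blast
  then show "dir_deriv X (f - h) p = (dir_deriv X f - dir_deriv X h) p"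
    by (simp add: dir_deriv_def fun_diff_def)
qed


section \<open>Norden metrics\<close>

locale norden =
  fixes n :: nat
    and A :: "('m::{t2_space,second_countable_topology} set \<times> ('m \<Rightarrow> 'e::euclidean_space)) set"
    and J :: "'m \<Rightarrow> 'm tvec \<Rightarrow> 'm tvec"
    and g :: "'m \<Rightarrow> 'm tvec \<Rightarrow> 'm tvec \<Rightarrow> real"
  assumes norden: "almost_complex_norden n A J g"
begin

lemma atlas: "smooth_atlas A"
  and tensor_J: "tensor11 A J"
  and metric: "pseudo_riemannian_metric A g"
  using norden by (auto simp: almost_complex_norden_def)

lemma field_at: "X \<in> vector_fields A \<Longrightarrow> X p \<in> tangent_space A p"
  by (simp add: vector_fields_def)

lemmas add_field = vector_fields_add[OF atlas]
  and diff_field = vector_fields_diff[OF atlas]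

lemma J_field: "X \<in> vector_fields A \<Longrightarrow> app11 J X \<in> vector_fields A"
  using tensor_J by (simp add: tensor11_def)

lemma J_lincomb:
  assumes "X \<in> vector_fields A" "Y \<in> vector_fields A"
  shows "app11 J (\<lambda>p. lincomb a (X p) b (Y p)) = (\<lambda>p. lincomb a (app11 J X p) b (app11 J Y p))"
  using assms tensor_J unfolding tensor11_def app11_def by (simp add: field_at)

lemma J_add: "X \<in> vector_fields A \<Longrightarrow> Y \<in> vector_fields A \<Longrightarrow> app11 J (X + Y) = app11 J X + app11 J Y"
  and J_diff: "X \<in> vector_fields A \<Longrightarrow> Y \<in> vector_fields A \<Longrightarrow> app11 J (X - Y) = app11 J X - app11 J Y"
  using J_lincomb[of X Y 1 1] J_lincomb[of X Y 1 "-1"] by (simp_all add: lincomb_add lincomb_diff plus_fun_def fun_diff_def)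

lemma J_J: "X \<in> vector_fields A \<Longrightarrow> app11 J (app11 J X) = - X"
  using norden by (auto simp: almost_complex_norden_def app11_def field_at fun_eq_iff)

lemma g_commute:
  "X \<in> vector_fields A \<Longrightarrow> Y \<in> vector_fields A \<Longrightarrow> app02 g X Y = app02 g Y X"
  using metric by (intro ext) (simp add: pseudo_riemannian_metric_def app02_def field_at)

lemma g_smooth:
  "X \<in> vector_fields A \<Longrightarrow> Y \<in> vector_fields A \<Longrightarrow> app02 g X Y \<in> smooth_funs A"
  using metric by (simp add: pseudo_riemannian_metric_def)

lemma g_lincomb_left:
  assumes "X \<in> vector_fields A" "Y \<in> vector_fields A" "Z \<in> vector_fields A"
  shows "app02 g (\<lambda>p. lincomb a (X p) b (Y p)) Z p = a * app02 g X Z p + b * app02 g Y Z p"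
  using assms metric by (simp add: pseudo_riemannian_metric_def app02_def field_at)

lemma g_add_left:
  assumes "X \<in> vector_fields A" "Y \<in> vector_fields A" "Z \<in> vector_fields A"
  shows "app02 g (X + Y) Z = app02 g X Z + app02 g Y Z"
  using g_lincomb_left[OF assms, of 1 1] by (intro ext) (simp add: lincomb_add plus_fun_def)

lemma g_diff_left:
  assumes "X \<in> vector_fields A" "Y \<in> vector_fields A" "Z \<in> vector_fields A"
  shows "app02 g (X - Y) Z = app02 g X Z - app02 g Y Z"
  using g_lincomb_left[OF assms, of 1 "-1"] by (intro ext) (simp add: lincomb_diff fun_diff_def)

lemma g_add_right:
  assumes "X \<in> vector_fields A" "Y \<in> vector_fields A" "Z \<in> vector_fields A"
  shows "app02 g Z (X + Y) = app02 g Z X + app02 g Z Y"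
  using assms by (simp add: g_commute[of Z] add_field g_add_left)

lemma g_diff_right:
  assumes "X \<in> vector_fields A" "Y \<in> vector_fields A" "Z \<in> vector_fields A"
  shows "app02 g Z (X - Y) = app02 g Z X - app02 g Z Y"
  using assms by (simp add: g_commute[of Z] diff_field g_diff_left)

lemma g_J_J:
  "X \<in> vector_fields A \<Longrightarrow> Y \<in> vector_fields A \<Longrightarrow> app02 g (app11 J X) (app11 J Y) = - app02 g X Y"
  using norden by (auto simp: almost_complex_norden_def app02_def app11_def field_at)

lemma zero_field: "X \<in> vector_fields A \<Longrightarrow> 0 \<in> vector_fields A"
  using diff_field[of X X] by simp

lemma minus_field: "X \<in> vector_fields A \<Longrightarrow> - X \<in> vector_fields A"
  using diff_field[of 0 X] zero_field[of X] by simp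

lemma g_minus_right:
  "X \<in> vector_fields A \<Longrightarrow> Z \<in> vector_fields A \<Longrightarrow> app02 g Z (- X) = - app02 g Z X"
  using g_add_right[of X "- X" Z] g_diff_right[of X X Z] minus_field[of X]
  by (simp add: eq_neg_iff_add_eq_0 add.commute)

text \<open>The Norden condition for \<open>X\<close> and \<open>J Y\<close>, combined with
  \<open>J (J Y) = - Y\<close>, makes \<open>J\<close> self-adjoint for \<open>g\<close>, whereas it
  is skew for a Hermitian metric.\<close>

lemma g_J_swap:
  assumes "X \<in> vector_fields A" "Y \<in> vector_fields A"
  shows "app02 g (app11 J X) Y = app02 g X (app11 J Y)"
proof -
  have "app02 g (app11 J X) (- Y) = - app02 g X (app11 J Y)"
    using g_J_J[of X "app11 J Y"] assms by (simp add: J_J J_field)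
  then show ?thesis using assms by (simp add: g_minus_right J_field)
qed

lemma associated_eq: "app02 (associated_metric J g) X Y = app02 g X (app11 J Y)"
  by (simp add: app02_def associated_metric_def app11_def)

lemmas bilinear = g_add_left g_diff_left g_add_right g_diff_right g_minus_right

end


section \<open>Quasi-Kaehler manifolds with Norden metric\<close>

locale quasi_kaehler =
  fixes n :: nat
    and A :: "('m::{t2_space,second_countable_topology} set \<times> ('m \<Rightarrow> 'e::euclidean_space)) set"
    and J :: "'m \<Rightarrow> 'm tvec \<Rightarrow> 'm tvec"
    and g :: "'m \<Rightarrow> 'm tvec \<Rightarrow> 'm tvec \<Rightarrow> real"
    and D :: "'m field \<Rightarrow> 'm field \<Rightarrow> 'm field"
  assumes quasi: "quasi_kaehler_norden n A J g D"

sublocale quasi_kaehler \<subseteq> norden n A J g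
  using quasi by unfold_locales (simp add: quasi_kaehler_norden_def)

context quasi_kaehler
begin

abbreviation "C \<equiv> cov_deriv11 D J"
abbreviation "F \<equiv> fundamental_tensor J g D"

lemma levi_civita_D: "levi_civita A g D"
  using quasi by (simp add: quasi_kaehler_norden_def)

lemma D_field: "X \<in> vector_fields A \<Longrightarrow> Y \<in> vector_fields A \<Longrightarrow> D X Y \<in> vector_fields A"
  using levi_civita_D by (simp add: levi_civita_def affine_connection_def)

lemma D_add:
  "X \<in> vector_fields A \<Longrightarrow> Y \<in> vector_fields A \<Longrightarrow> Z \<in> vector_fields A \<Longrightarrow> D X (Y + Z) = D X Y + D X Z"
  using levi_civita_D by (simp add: levi_civita_def affine_connection_def)

lemma D_diff:
  assumes "X \<in> vector_fields A" "Y \<in> vector_fields A" "Z \<in> vector_fields A"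
  shows "D X (Y - Z) = D X Y - D X Z"
  using D_add[of X "Y - Z" Z] assms by (simp add: diff_field)

lemma D_minus:
  assumes "X \<in> vector_fields A" "Y \<in> vector_fields A"
  shows "D X (- Y) = - D X Y"
  using D_diff[of X 0 Y] D_diff[of X Y Y] assms by (simp add: zero_field)

lemma bracket_eq:
  "X \<in> vector_fields A \<Longrightarrow> Y \<in> vector_fields A \<Longrightarrow> lie_bracket X Y = D X Y - D Y X"
  using levi_civita_D by (simp add: levi_civita_def)

lemma compat:
  assumes "X \<in> vector_fields A" "Y \<in> vector_fields A" "Z \<in> vector_fields A"
  shows "dir_deriv X (app02 g Y Z) p = app02 g (D X Y) Z p + app02 g Y (D X Z) p"
proof -
  have "dir_deriv X (app02 g Y Z) = app02 g (D X Y) Z + app02 g Y (D X Z)"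
    using levi_civita_D assms by (simp add: levi_civita_def)
  then show ?thesis by simp
qed

section \<open>The covariant derivative of \<open>J\<close> and the tensor \<open>F\<close>\<close>

lemma C_field: "X \<in> vector_fields A \<Longrightarrow> Y \<in> vector_fields A \<Longrightarrow> C X Y \<in> vector_fields A"
  by (simp add: cov_deriv11_def D_field J_field diff_field)

lemmas fields = add_field diff_field J_field D_field C_field minus_field

lemma D_J: "D X (app11 J Y) = C X Y + app11 J (D X Y)"
  by (simp add: cov_deriv11_def)

text \<open>This is the covariant derivative of \<open>J (J Y) = - Y\<close>.\<close>

lemma C_J:
  assumes "X \<in> vector_fields A" "Y \<in> vector_fields A"
  shows "C X (app11 J Y) = - app11 J (C X Y)"
  using assms by (simp add: cov_deriv11_def J_J J_diff D_minus fields)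

lemma F_eq: "F X Y Z = app02 g (C X Y) Z"
  by (simp add: fundamental_tensor_def)

lemma F_smooth:
  "X \<in> vector_fields A \<Longrightarrow> Y \<in> vector_fields A \<Longrightarrow> Z \<in> vector_fields A \<Longrightarrow> F X Y Z \<in> smooth_funs A"
  by (simp add: F_eq g_smooth fields)

text \<open>Splits the bracket, a difference of two covariant derivatives, when it stands in the
  middle slot of \<open>F\<close>.\<close>

lemma F_diff_middle:
  assumes "X \<in> vector_fields A" "Y \<in> vector_fields A" "Z \<in> vector_fields A" "W \<in> vector_fields A"
  shows "F X (Y - Z) W = F X Y W - F X Z W"
proof -
  have "C X (Y - Z) = C X Y - C X Z"
    using assms by (simp add: cov_deriv11_def D_diff J_diff fields algebra_simps)
  then show ?thesis using assms by (simp add: F_eq g_diff_left fields)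
qed

text \<open>A metric connection differentiates the self-adjoint \<open>J\<close> to a self-adjoint
  endomorphism: expand the derivatives of both sides of
  \<open>g(J Y, Z) = g(Y, J Z)\<close>.\<close>

lemma F_commute:
  assumes "X \<in> vector_fields A" "Y \<in> vector_fields A" "Z \<in> vector_fields A"
  shows "F X Y Z = F X Z Y"
proof
  fix p
  have "dir_deriv X (app02 g (app11 J Y) Z) p = dir_deriv X (app02 g Y (app11 J Z)) p"
    using assms by (simp add: g_J_swap)
  then have "app02 g (D X (app11 J Y)) Z p + app02 g (app11 J Y) (D X Z) p
    = app02 g (D X Y) (app11 J Z) p + app02 g Y (D X (app11 J Z)) p"
    using assms by (simp add: compat fields)
  then show "F X Y Z p = F X Z Y p"
    using assms by (simp add: F_eq D_J bilinear fields g_J_swap g_commute[of Y])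
qed

lemma F_cyclic:
  assumes "X \<in> vector_fields A" "Y \<in> vector_fields A" "Z \<in> vector_fields A"
  shows "F X Y Z p + F Y Z X p + F Z X Y p = 0"
proof -
  have "F X Y Z + F Y Z X + F Z X Y = 0"
    using quasi assms by (simp add: quasi_kaehler_norden_def)
  from fun_cong[OF this, of p] show ?thesis by simp
qed

end


section \<open>The Levi-Civita connection of the associated metric\<close>

locale associated_connection = quasi_kaehler n A J g D
  for n and A :: "('m::{t2_space,second_countable_topology} set \<times> ('m \<Rightarrow> 'e::euclidean_space)) set"
    and J g D +
  fixes D' :: "'m field \<Rightarrow> 'm field \<Rightarrow> 'm field"
  assumes levi_civita_D': "levi_civita A (associated_metric J g) D'"
begin

lemma D'_field: "X \<in> vector_fields A \<Longrightarrow> Y \<in> vector_fields A \<Longrightarrow> D' X Y \<in> vector_fields A"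
  using levi_civita_D' by (simp add: levi_civita_def affine_connection_def)

text \<open>Both connections are torsion-free, so the bracket cancels in the difference.\<close>

lemma D'_minus_D_commute:
  assumes "X \<in> vector_fields A" "Y \<in> vector_fields A"
  shows "D' X Y - D X Y = D' Y X - D Y X"
proof -
  have "D' X Y - D' Y X = lie_bracket X Y"
    using levi_civita_D' assms by (simp add: levi_civita_def)
  then show ?thesis using bracket_eq[OF assms] by (simp add: algebra_simps)
qed

lemma compat':
  assumes "X \<in> vector_fields A" "Y \<in> vector_fields A" "Z \<in> vector_fields A"
  shows "dir_deriv X (app02 g Y (app11 J Z)) p = app02 g (D' X Y) (app11 J Z) p + app02 g Y (app11 J (D' X Z)) p"
proof -
  have "dir_deriv X (app02 (associated_metric J g) Y Z)
      = app02 (associated_metric J g) (D' X Y) Z + app02 (associated_metric J g) Y (D' X Z)"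
    using levi_civita_D' assms by (simp add: levi_civita_def)
  then show ?thesis by (simp add: associated_eq)
qed

lemma difference_pairing:
  assumes X: "X \<in> vector_fields A" and Y: "Y \<in> vector_fields A" and Z: "Z \<in> vector_fields A"
  shows "app02 g (D' X Y - D X Y) (app11 J Z) = - F Z X Y"
proof
  fix p
  define a where "a X Y Z = app02 g (D' X Y - D X Y) (app11 J Z) p" for X Y Z
  \<comment> \<open>The one function \<open>g(Y, J Z)\<close> is differentiated with both
    connections. \<open>D\<close> does not preserve the associated metric, and its defect is
    \<open>g(Y, C X Z)\<close>, that is \<open>F X Y Z\<close>.\<close>
  have a_sum: "a X Y Z + a X Z Y = F X Y Z p"
    if "X \<in> vector_fields A" "Y \<in> vector_fields A" "Z \<in> vector_fields A" for X Y Z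
  proof -
    have "app02 g (D' X Y) (app11 J Z) p + app02 g Y (app11 J (D' X Z)) p
      = app02 g (D X Y) (app11 J Z) p + app02 g Y (C X Z + app11 J (D X Z)) p"
      using compat'[OF that, of p] compat[of X Y "app11 J Z" p] that by (simp add: J_field D_J)
    moreover have "app02 g Y (app11 J (D' X Z)) = app02 g (D' X Z) (app11 J Y)"
      "app02 g Y (app11 J (D X Z)) = app02 g (D X Z) (app11 J Y)"
      using that by (simp_all add: g_commute[of Y] g_J_swap fields D'_field)
    moreover have "app02 g Y (C X Z) = F X Y Z"
      using F_commute[OF that] that by (simp add: F_eq g_commute[of Y] fields)
    ultimately show ?thesis
      using that by (simp add: a_def bilinear fields D'_field)
  qed
  have a_commute: "a X Y Z = a Y X Z" if "X \<in> vector_fields A" "Y \<in> vector_fields A" for X Y Z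
    using D'_minus_D_commute[OF that] by (simp add: a_def)
  have "F X Y Z p + F Y Z X p + F Z X Y p = 0"
    using F_cyclic X Y Z by blast
  moreover have "F Y Z X p = F Y X Z p"
    using F_commute X Y Z by metis
  \<comment> \<open>The first two sums minus the third give
    \<open>2 * a X Y Z = F X Y Z + F Y X Z - F Z X Y\<close> at \<open>p\<close>; by the cyclic
    identity the right-hand side is \<open>-2 * F Z X Y\<close>.\<close>
  ultimately have "a X Y Z = - F Z X Y p"
    using a_sum[OF X Y Z] a_sum[OF Y X Z] a_sum[OF Z X Y]
      a_commute[OF X Y, of Z] a_commute[OF X Z, of Y] a_commute[OF Y Z, of X] by linarith
  then show "app02 g (D' X Y - D X Y) (app11 J Z) p = (- F Z X Y) p"
    by (simp add: a_def)
qed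

lemma connection_pairing:
  assumes "X \<in> vector_fields A" "Y \<in> vector_fields A" "Z \<in> vector_fields A"
  shows "app02 g (D' X Y) (app11 J Z) = app02 g (D X Y) (app11 J Z) - F Z X Y"
  using difference_pairing[OF assms] assms
  by (simp add: g_diff_left fields D'_field algebra_simps)

text \<open>Pairs the difference with an arbitrary field by writing \<open>Q\<close> as
  \<open>- J (J Q)\<close>. The cyclic identity then moves \<open>J Q\<close> from the first slot of
  \<open>F\<close> to the last.\<close>

lemma difference_pairing_J:
  assumes "Y \<in> vector_fields A" "Z \<in> vector_fields A" "Q \<in> vector_fields A"
  shows "app02 g (D' Y Z - D Y Z) Q p = - app02 g (C Y Z + C Z Y) (app11 J Q) p"
proof -
  have "app02 g (D' Y Z - D Y Z) Q = - app02 g (D' Y Z - D Y Z) (app11 J (app11 J Q))"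
    using assms by (simp add: J_J g_minus_right fields D'_field)
  then have "app02 g (D' Y Z - D Y Z) Q p = F (app11 J Q) Y Z p"
    using assms by (simp add: difference_pairing J_field)
  then show ?thesis
    using F_cyclic[of "app11 J Q" Y Z p] F_commute[of Z "app11 J Q" Y] assms
    by (simp add: F_eq g_add_left fields)
qed

text \<open>The outer \<open>D'\<close> is exchanged for \<open>D\<close> directly. The inner one
  sits under \<open>D x\<close>, so metric compatibility first moves that derivative onto the scalar
  \<open>g(D' y z, J u)\<close>, where the exchange is possible, and then back.\<close>

lemma second_derivative_pairing:
  assumes x: "x \<in> vector_fields A" and y: "y \<in> vector_fields A"
    and z: "z \<in> vector_fields A" and u: "u \<in> vector_fields A"
  shows "app02 g (D' x (D' y z)) (app11 J u) p =
      app02 g (D x (D y z)) (app11 J u) p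
      - dir_deriv x (F u y z) p + F (D x u) y z p - F u x (D y z) p
      - app02 g (C y z + C z y) (C x (app11 J u) + C u (app11 J x)) p"
proof -
  note fs = x y z u fields D'_field
  let ?W = "D' y z" and ?S = "D' y z - D y z"
  have 1: "app02 g (D' x ?W) (app11 J u) p = app02 g (D x ?W) (app11 J u) p - F u x ?W p"
    by (simp add: connection_pairing fs)
  have 2: "app02 g (D x ?W) (app11 J u) p
      = dir_deriv x (app02 g ?W (app11 J u)) p - app02 g ?W (D x (app11 J u)) p"
    by (simp add: compat fs)
  have 3: "dir_deriv x (app02 g ?W (app11 J u)) p
      = app02 g (D x (D y z)) (app11 J u) p + app02 g (D y z) (D x (app11 J u)) p
        - dir_deriv x (F u y z) p"
    by (simp add: connection_pairing dir_deriv_diff[where A = A] g_smooth F_smooth compat fs)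
  \<comment> \<open>\<open>D x (J u)\<close> splits into \<open>C x u\<close> and
    \<open>J (D x u)\<close>; the second part is a \<open>J\<close>-image, so its pairing with
    \<open>?S\<close> is a value of \<open>F\<close>.\<close>
  have 4: "app02 g ?W (D x (app11 J u)) p - app02 g (D y z) (D x (app11 J u)) p
      = app02 g ?S (C x u) p - F (D x u) y z p"
    using fun_cong[OF difference_pairing[of y z "D x u"], of p] by (simp add: D_J bilinear fs)
  have 5: "F u x ?W p = F u x (D y z) p + app02 g ?S (C u x) p"
    by (simp add: F_eq g_commute[of "C u x"] bilinear fs)
  \<comment> \<open>The leftovers of steps 4 and 5 combine to the symmetrised derivative of
    \<open>J\<close>; \<open>C_J\<close> then absorbs the outer \<open>J\<close> into its arguments
    with a change of sign.\<close>
  have "app02 g ?S (C x u + C u x) p = - app02 g (C y z + C z y) (app11 J (C x u + C u x)) p"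
    by (rule difference_pairing_J) (simp_all add: fs)
  then have "app02 g ?S (C x u) p + app02 g ?S (C u x) p
      = app02 g (C y z + C z y) (C x (app11 J u) + C u (app11 J x)) p"
    by (simp add: C_J J_add bilinear fs)
  with 1 2 3 4 5 show ?thesis by linarith
qed

end

section \<open>Antisymmetrisation to the curvature identity\<close>

theorem theorem2p3:
  fixes n :: nat
    and A :: "('m::{t2_space,second_countable_topology} set \<times> ('m \<Rightarrow> 'e::euclidean_space)) set"
    and J :: "'m \<Rightarrow> 'm tvec \<Rightarrow> 'm tvec"
    and g g' :: "'m \<Rightarrow> 'm tvec \<Rightarrow> 'm tvec \<Rightarrow> real"
    and D D' :: "'m field \<Rightarrow> 'm field \<Rightarrow> 'm field"
    and F :: "'m field \<Rightarrow> 'm field \<Rightarrow> 'm field \<Rightarrow> 'm \<Rightarrow> real"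
    and x y z u :: "'m field"
    and p :: 'm
  assumes "g' = associated_metric J g"
    and "quasi_kaehler_norden n A J g D"
    and "quasi_kaehler_norden n A J g' D'"
    and "F = fundamental_tensor J g D"
    and "x \<in> vector_fields A" "y \<in> vector_fields A" "z \<in> vector_fields A" "u \<in> vector_fields A"
  shows "curvature04 g' D' x y z u p =
      curvature04 g D x y z (app11 J u) p
      - cov_deriv03 D F x u y z p
      + cov_deriv03 D F y u x z p
      - app02 g (cov_deriv11 D J y z + cov_deriv11 D J z y)
                (cov_deriv11 D J x (app11 J u) + cov_deriv11 D J u (app11 J x)) p
      + app02 g (cov_deriv11 D J x z + cov_deriv11 D J z x)
                (cov_deriv11 D J y (app11 J u) + cov_deriv11 D J u (app11 J y)) p"
proof -
  interpret associated_connection n A J g D D'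
    using assms(1-3) by unfold_locales (auto simp: quasi_kaehler_norden_def)
  note fs = assms(5-8) fields D'_field
  have bracket: "lie_bracket x y = D x y - D y x"
    by (simp add: bracket_eq fs)
  then have L: "lie_bracket x y \<in> vector_fields A"
    by (simp add: fs)
  have R': "curvature04 g' D' x y z u p = app02 g (D' x (D' y z)) (app11 J u) p
      - app02 g (D' y (D' x z)) (app11 J u) p - app02 g (D' (lie_bracket x y) z) (app11 J u) p"
    unfolding curvature04_def curvature_def assms(1) associated_eq by (simp add: bilinear L fs)
  have R: "curvature04 g D x y z (app11 J u) p = app02 g (D x (D y z)) (app11 J u) p
      - app02 g (D y (D x z)) (app11 J u) p - app02 g (D (lie_bracket x y) z) (app11 J u) p"
    unfolding curvature04_def curvature_def by (simp add: bilinear L fs)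
  \<comment> \<open>The bracket term supplies the \<open>F u (D x y) z\<close> and
    \<open>F u (D y x) z\<close> parts of the two covariant derivatives of \<open>F\<close>.\<close>
  have "app02 g (D' (lie_bracket x y) z) (app11 J u) p
      = app02 g (D (lie_bracket x y) z) (app11 J u) p
        - fundamental_tensor J g D u (lie_bracket x y) z p"
    by (simp add: connection_pairing L fs)
  moreover have "fundamental_tensor J g D u (lie_bracket x y) z p
      = fundamental_tensor J g D u (D x y) z p - fundamental_tensor J g D u (D y x) z p"
    by (simp add: bracket F_diff_middle fs)
  \<comment> \<open>The terms cross over: \<open>F u x (D y z)\<close>, from differentiating along
    \<open>y\<close> and then \<open>x\<close>, belongs to the derivative of \<open>F\<close> along
    \<open>y\<close>, and \<open>F u y (D x z)\<close> to the one along \<open>x\<close>.\<close>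
  ultimately show ?thesis
    using second_derivative_pairing[OF assms(5,6,7,8), of p]
      second_derivative_pairing[OF assms(6,5,7,8), of p]
    unfolding R R' cov_deriv03_def assms(4) by simp
qed

end
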